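(* Let $G(p)$ be a continuous tensegrity in $\mathbb{R}^n$ with (compact) edgeset $\mathscr{E}$, rigidity operator $Y$ and space of design variations $\mathcal{X}$. If $G(p)$ is minimally $\mathcal{X}$-bar equivalent, then $G(p)$ has a strictly positive stress.
   Context: A (continuous) tensegrity $G(p)$ in $\mathbb{R}^n$ consists of a (possibly infinite) set $\mathscr{V}$ of vertices, an injective map $p:\mathscr{V}\to\mathbb{R}^n$, and three pairwise disjoint sets $\mathsf{S}$ (struts), $\mathsf{C}$ (cables), $\mathsf{B}$ (bars) of two-element subsets of $\mathscr{V}$. The set $\mathscr{V}$ carries the metric $d_{\mathscr V}(v,w)=\|p(v)-p(w)\|$. Put $\mathscr{S}=\mathsf{S}\cup\mathsf{B}$ and $\mathscr{C}=\mathsf{C}\cup\mathsf{B}$ (functional struts and cables). The edgeset is the disjoint union $\mathscr{E}=\mathscr{S}\sqcup\mathscr{C}$ (so a bar occurs twice, once as a strut and once as a cable). Two edges of the same type have distance $\min\{\max(d_{\mathscr V}(v_1,v_3),d_{\mathscr V}(v_2,v_4)),\max(d_{\mathscr V}(v_1,v_4),d_{\mathscr V}(v_2,v_3))\}$ for edges $\{v_1,v_2\},\{v_3,v_4\}$; edges of different types have distance $\infty$. $\mathscr{E}$ has the metric topology and is required to be compact. $\mathrm{Vf}(\mathscr{V})$ is the space of continuous maps $V:\mathscr{V}\to\mathbb{R}^n$ (variations). $T(p)$ is the set of Euclidean motions, i.e. variations $v\mapsto Mp(v)+t$ with $M$ a skew-symmetric $n\times n$ matrix and $t\in\mathbb{R}^n$.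 The design variations form a linear subspace $\mathcal{X}\subset\mathrm{Vf}(\mathscr{V})$ with $T(p)\subset\mathcal{X}$. The rigidity operator $Y:\mathrm{Vf}(\mathscr{V})\to C(\mathscr{E})$ is $(YV)(\{v_1,v_2\})=\pm(V(v_1)-V(v_2))\cdot(p(v_1)-p(v_2))$, with sign $+$ on $\mathscr{S}$ and $-$ on $\mathscr{C}$. $C(\mathscr{E})$ is the space of continuous real functions on $\mathscr{E}$ with the sup norm, $C(\mathscr{E})^+$ the set of nonnegative ones, and $C^*(\mathscr{E})$ the topological dual of $C(\mathscr{E})$. A stress is a $\mu\in C^*(\mathscr{E})$ with $\mu(YV)=0$ for all $V\in\mathcal{X}$; a strictly positive stress is a stress $\mu$ with $\mu(f)>0$ for all nonzero $f\in C(\mathscr{E})^+$. $G(p)$ is $\mathcal{X}$-bar equivalent if every $V\in\mathcal{X}$ with $YV\in C(\mathscr{E})^+$ satisfies $YV=0$. For a closed subset $\mathscr{E}'\subset\mathscr{E}$, the subtensegrity with edgeset $\mathscr{E}'$ has the same $\mathscr{V}$, $p$ and $\mathcal{X}$, edgeset $\mathscr{E}'$, and rigidity operator $V\mapsto (YV)|_{\mathscr{E}'}$; it is $\mathcal{X}$-bar equivalent if every $V\in\mathcal{X}$ with $(YV)|_{\mathscr{E}'}\ge 0$ satisfies $(YV)|_{\mathscr{E}'}=0$. $G(p)$ is minimally $\mathcal{X}$-bar equivalent if it is $\mathcal{X}$-bar equivalent but for every nonempty open $U\subset\mathscr{E}$ with $\mathscr{E}\setminus U\neq\varnothing$, the subtensegrity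 with edgeset $\mathscr{E}\setminus U$ is not $\mathcal{X}$-bar equivalent. *)

theory Defs
  imports "HOL-Analysis.Analysis"
begin

text \<open>
  Function spaces over a carrier set are represented by the total functions that vanish off the
  carrier. Restriction to the carrier is then a linear isomorphism onto the genuine function space,
  and the vector space operations and equality are those of the ambient function type.
\<close>

record ('v, 'n::finite) tensegrity =
  verts :: "'v set"
  pos :: "'v \<Rightarrow> real ^ 'n"
  struts :: "'v set set"
  cables :: "'v set set"
  bars :: "'v set set"

text \<open>
  Edges are tagged: \<open>Inl e\<close> is \<open>e\<close> as a functional strut and \<open>Inr e\<close> is \<open>e\<close> as a functional cable,
  so a bar contributes two edges.
\<close>

type_synonym 'v edge = "'v set + 'v set"

definition edgeset :: "('v, 'n::finite) tensegrity \<Rightarrow> 'v edge set" where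
  "edgeset G = (struts G \<union> bars G) <+> (cables G \<union> bars G)"

definition vdist :: "('v, 'n::finite) tensegrity \<Rightarrow> 'v \<Rightarrow> 'v \<Rightarrow> real" where
  "vdist G v w = norm (pos G v - pos G w)"

definition vertex_topology :: "('v, 'n::finite) tensegrity \<Rightarrow> 'v topology" where
  "vertex_topology G = Metric_space.mtopology (verts G) (vdist G)"

text \<open>
  The descriptions below do not depend on how the elements of the edges are labelled; see the
  lemmas \<open>pair_dist_eq\<close> and \<open>pair_form_eq\<close>.
\<close>

definition pair_dist :: "('v, 'n::finite) tensegrity \<Rightarrow> 'v set \<Rightarrow> 'v set \<Rightarrow> real" where
  "pair_dist G e f = (THE r. \<exists>v1 v2 v3 v4. e = {v1, v2} \<and> f = {v3, v4} \<and>
     r = min (max (vdist G v1 v3) (vdist G v2 v4)) (max (vdist G v1 v4) (vdist G v2 v3)))"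

fun edge_dist :: "('v, 'n::finite) tensegrity \<Rightarrow> 'v edge \<Rightarrow> 'v edge \<Rightarrow> ereal" where
  "edge_dist G (Inl e) (Inl f) = ereal (pair_dist G e f)"
| "edge_dist G (Inr e) (Inr f) = ereal (pair_dist G e f)"
| "edge_dist G (Inl e) (Inr f) = \<infinity>"
| "edge_dist G (Inr e) (Inl f) = \<infinity>"

definition edge_topology :: "('v, 'n::finite) tensegrity \<Rightarrow> 'v edge topology" where
  "edge_topology G = topology (\<lambda>U. U \<subseteq> edgeset G \<and>
     (\<forall>x\<in>U. \<exists>\<epsilon>>0. \<forall>y\<in>edgeset G. edge_dist G x y < ereal \<epsilon> \<longrightarrow> y \<in> U))"

definition is_tensegrity :: "('v, 'n::finite) tensegrity \<Rightarrow> bool" where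
  "is_tensegrity G \<longleftrightarrow>
     inj_on (pos G) (verts G) \<and>
     (\<forall>e \<in> struts G \<union> cables G \<union> bars G. e \<subseteq> verts G \<and> card e = 2) \<and>
     struts G \<inter> cables G = {} \<and> struts G \<inter> bars G = {} \<and> cables G \<inter> bars G = {} \<and>
     compact_space (edge_topology G)"

definition variations :: "('v, 'n::finite) tensegrity \<Rightarrow> ('v \<Rightarrow> real ^ 'n) set" where
  "variations G = {V. continuous_map (vertex_topology G) euclidean V \<and> (\<forall>v. v \<notin> verts G \<longrightarrow> V v = 0)}"

definition euclidean_motions :: "('v, 'n::finite) tensegrity \<Rightarrow> ('v \<Rightarrow> real ^ 'n) set" where
  "euclidean_motions G =
     {(\<lambda>v. if v \<in> verts G then M *v pos G v + t else 0) | M t. transpose M = - M}"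

definition design_variations ::
    "('v, 'n::finite) tensegrity \<Rightarrow> ('v \<Rightarrow> real ^ 'n) set \<Rightarrow> bool" where
  "design_variations G X \<longleftrightarrow>
     X \<subseteq> variations G \<and> euclidean_motions G \<subseteq> X \<and>
     (\<lambda>v. 0) \<in> X \<and>
     (\<forall>V\<in>X. \<forall>W\<in>X. (\<lambda>v. V v + W v) \<in> X) \<and>
     (\<forall>V\<in>X. \<forall>c::real. (\<lambda>v. c *\<^sub>R V v) \<in> X)"

definition edge_functions :: "('v, 'n::finite) tensegrity \<Rightarrow> ('v edge \<Rightarrow> real) set" where
  "edge_functions G =
     {f. continuous_map (edge_topology G) euclideanreal f \<and> (\<forall>x. x \<notin> edgeset G \<longrightarrow> f x = 0)}"

definition nonneg_edge_functions :: "('v, 'n::finite) tensegrity \<Rightarrow> ('v edge \<Rightarrow> real) set" where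
  "nonneg_edge_functions G = {f \<in> edge_functions G. \<forall>x\<in>edgeset G. 0 \<le> f x}"

text \<open>Inserting \<open>0\<close> makes the norm \<open>0\<close> when there are no edges, and changes nothing otherwise.\<close>

definition sup_norm :: "('v, 'n::finite) tensegrity \<Rightarrow> ('v edge \<Rightarrow> real) \<Rightarrow> real" where
  "sup_norm G f = Sup (insert 0 ((\<lambda>x. \<bar>f x\<bar>) ` edgeset G))"

text \<open>Only the values of a functional on \<open>edge_functions G\<close> are relevant.\<close>

definition dual_space :: "('v, 'n::finite) tensegrity \<Rightarrow> (('v edge \<Rightarrow> real) \<Rightarrow> real) set" where
  "dual_space G = {\<mu>.
     (\<forall>f\<in>edge_functions G. \<forall>g\<in>edge_functions G. \<mu> (\<lambda>x. f x + g x) = \<mu> f + \<mu> g) \<and>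
     (\<forall>f\<in>edge_functions G. \<forall>c. \<mu> (\<lambda>x. c * f x) = c * \<mu> f) \<and>
     (\<forall>f\<in>edge_functions G. \<forall>\<epsilon>>0. \<exists>\<delta>>0. \<forall>g\<in>edge_functions G.
        sup_norm G (\<lambda>x. g x - f x) < \<delta> \<longrightarrow> \<bar>\<mu> g - \<mu> f\<bar> < \<epsilon>)}"

definition pair_form :: "('v, 'n::finite) tensegrity \<Rightarrow> ('v \<Rightarrow> real ^ 'n) \<Rightarrow> 'v set \<Rightarrow> real" where
  "pair_form G V e = (THE r. \<exists>v1 v2. e = {v1, v2} \<and> r = (V v1 - V v2) \<bullet> (pos G v1 - pos G v2))"

definition rigidity ::
    "('v, 'n::finite) tensegrity \<Rightarrow> ('v \<Rightarrow> real ^ 'n) \<Rightarrow> 'v edge \<Rightarrow> real" where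
  "rigidity G V x =
     (if x \<in> edgeset G then (case x of Inl e \<Rightarrow> pair_form G V e | Inr e \<Rightarrow> - pair_form G V e) else 0)"

definition stress ::
    "('v, 'n::finite) tensegrity \<Rightarrow> ('v \<Rightarrow> real ^ 'n) set \<Rightarrow> (('v edge \<Rightarrow> real) \<Rightarrow> real) \<Rightarrow> bool" where
  "stress G X \<mu> \<longleftrightarrow> \<mu> \<in> dual_space G \<and> (\<forall>V\<in>X. \<mu> (rigidity G V) = 0)"

definition strictly_positive_stress ::
    "('v, 'n::finite) tensegrity \<Rightarrow> ('v \<Rightarrow> real ^ 'n) set \<Rightarrow> (('v edge \<Rightarrow> real) \<Rightarrow> real) \<Rightarrow> bool" where
  "strictly_positive_stress G X \<mu> \<longleftrightarrow>
     stress G X \<mu> \<and> (\<forall>f\<in>nonneg_edge_functions G. f \<noteq> (\<lambda>x. 0) \<longrightarrow> 0 < \<mu> f)"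

definition bar_equivalent ::
    "('v, 'n::finite) tensegrity \<Rightarrow> ('v \<Rightarrow> real ^ 'n) set \<Rightarrow> bool" where
  "bar_equivalent G X \<longleftrightarrow>
     (\<forall>V\<in>X. rigidity G V \<in> nonneg_edge_functions G \<longrightarrow> rigidity G V = (\<lambda>x. 0))"

definition sub_bar_equivalent ::
    "('v, 'n::finite) tensegrity \<Rightarrow> ('v \<Rightarrow> real ^ 'n) set \<Rightarrow> 'v edge set \<Rightarrow> bool" where
  "sub_bar_equivalent G X E' \<longleftrightarrow>
     (\<forall>V\<in>X. (\<forall>x\<in>E'. 0 \<le> rigidity G V x) \<longrightarrow> (\<forall>x\<in>E'. rigidity G V x = 0))"

definition minimally_bar_equivalent ::
    "('v, 'n::finite) tensegrity \<Rightarrow> ('v \<Rightarrow> real ^ 'n) set \<Rightarrow> bool" where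
  "minimally_bar_equivalent G X \<longleftrightarrow>
     bar_equivalent G X \<and>
     (\<forall>U. openin (edge_topology G) U \<and> U \<noteq> {} \<and> edgeset G - U \<noteq> {} \<longrightarrow>
        \<not> sub_bar_equivalent G X (edgeset G - U))"

subsection \<open>Well-definedness\<close>

lemma vdist_commute: "vdist G v w = vdist G w v"
  by (simp add: vdist_def norm_minus_commute)

lemma pair_dist_eq:
  "pair_dist G {v1, v2} {v3, v4} =
     min (max (vdist G v1 v3) (vdist G v2 v4)) (max (vdist G v1 v4) (vdist G v2 v3))"
  unfolding pair_dist_def
proof (rule the_equality)
  fix r
  assume "\<exists>w1 w2 w3 w4. {v1, v2} = {w1, w2} \<and> {v3, v4} = {w3, w4} \<and>
    r = min (max (vdist G w1 w3) (vdist G w2 w4)) (max (vdist G w1 w4) (vdist G w2 w3))"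
  then show "r = min (max (vdist G v1 v3) (vdist G v2 v4)) (max (vdist G v1 v4) (vdist G v2 v3))"
    by (auto simp: doubleton_eq_iff max.commute min.commute)
qed blast

lemma pair_form_eq: "pair_form G V {v1, v2} = (V v1 - V v2) \<bullet> (pos G v1 - pos G v2)"
  unfolding pair_form_def
proof (rule the_equality)
  fix r
  assume "\<exists>w1 w2. {v1, v2} = {w1, w2} \<and> r = (V w1 - V w2) \<bullet> (pos G w1 - pos G w2)"
  then show "r = (V v1 - V v2) \<bullet> (pos G v1 - pos G v2)"
    by (auto simp: doubleton_eq_iff algebra_simps inner_diff_left inner_diff_right)
qed blast

lemma Metric_space_vertices:
  assumes "is_tensegrity G"
  shows "Metric_space (verts G) (vdist G)"
proof
  show "vdist G x y = 0 \<longleftrightarrow> x = y" if "x \<in> verts G" "y \<in> verts G" for x y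
    using assms that by (auto simp: is_tensegrity_def vdist_def inj_on_def)
  show "vdist G x z \<le> vdist G x y + vdist G y z" for x y z
    using norm_triangle_ineq[of "pos G x - pos G y" "pos G y - pos G z"] by (simp add: vdist_def)
qed (simp_all add: vdist_commute, simp add: vdist_def)

lemma openin_edge_topology:
  "openin (edge_topology G) U \<longleftrightarrow> U \<subseteq> edgeset G \<and>
     (\<forall>x\<in>U. \<exists>\<epsilon>>0. \<forall>y\<in>edgeset G. edge_dist G x y < ereal \<epsilon> \<longrightarrow> y \<in> U)"
proof -
  let ?P = "\<lambda>U x \<epsilon>. \<forall>y\<in>edgeset G. edge_dist G x y < ereal \<epsilon> \<longrightarrow> y \<in> U"
  have "istopology (\<lambda>U. U \<subseteq> edgeset G \<and> (\<forall>x\<in>U. \<exists>\<epsilon>>0. ?P U x \<epsilon>))"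
    unfolding istopology_def
  proof (intro conjI allI impI; (elim conjE)?)
    fix S T
    assume S: "\<forall>x\<in>S. \<exists>\<epsilon>>0. ?P S x \<epsilon>" and T: "\<forall>x\<in>T. \<exists>\<epsilon>>0. ?P T x \<epsilon>"
    show "\<forall>x\<in>S \<inter> T. \<exists>\<epsilon>>0. ?P (S \<inter> T) x \<epsilon>"
    proof
      fix x assume "x \<in> S \<inter> T"
      then obtain a b where "0 < a" "?P S x a" "0 < b" "?P T x b" using S T by blast
      then have "0 < min a b \<and> ?P (S \<inter> T) x (min a b)"
        by (metis Int_iff ereal_less_eq(3) less_le_trans min.cobounded1 min.cobounded2 min_less_iff_conj)
      then show "\<exists>\<epsilon>>0. ?P (S \<inter> T) x \<epsilon>" by blast
    qed
  next
    fix K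
    assume K: "\<forall>S\<in>K. S \<subseteq> edgeset G \<and> (\<forall>x\<in>S. \<exists>\<epsilon>>0. ?P S x \<epsilon>)"
    then show "\<Union>K \<subseteq> edgeset G" by blast
    show "\<forall>x\<in>\<Union>K. \<exists>\<epsilon>>0. ?P (\<Union>K) x \<epsilon>"
    proof
      fix x assume "x \<in> \<Union>K"
      then obtain S where S: "S \<in> K" "x \<in> S" by blast
      then obtain a where "0 < a" "?P S x a" using K by blast
      then show "\<exists>\<epsilon>>0. ?P (\<Union>K) x \<epsilon>" using S by blast
    qed
  qed blast
  then show ?thesis by (simp add: edge_topology_def topology_inverse')
qed

lemma topspace_edge_topology [simp]: "topspace (edge_topology G) = edgeset G"
proof -
  have "openin (edge_topology G) (edgeset G)"
    by (auto simp: openin_edge_topology intro: exI[of _ 1])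
  then show ?thesis
    by (meson openin_edge_topology openin_subset openin_topspace subset_antisym)
qed

lemma vertex_topology_eq:
  assumes "is_tensegrity G"
  shows "topspace (vertex_topology G) = verts G"
    and "openin (vertex_topology G) U \<longleftrightarrow>
           U \<subseteq> verts G \<and> (\<forall>v\<in>U. \<exists>\<epsilon>>0. \<forall>w\<in>verts G. vdist G v w < \<epsilon> \<longrightarrow> w \<in> U)"
proof -
  interpret Metric_space "verts G" "vdist G" by (rule Metric_space_vertices[OF assms])
  show "topspace (vertex_topology G) = verts G" by (simp add: vertex_topology_def)
  show "openin (vertex_topology G) U \<longleftrightarrow>
          U \<subseteq> verts G \<and> (\<forall>v\<in>U. \<exists>\<epsilon>>0. \<forall>w\<in>verts G. vdist G v w < \<epsilon> \<longrightarrow> w \<in> U)"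
    unfolding vertex_topology_def openin_mtopology mball_def by blast
qed

lemma edge_cases:
  assumes "is_tensegrity G" "x \<in> edgeset G"
  obtains v w where "v \<in> verts G" "w \<in> verts G" "v \<noteq> w" "x = Inl {v, w}"
        | v w where "v \<in> verts G" "w \<in> verts G" "v \<noteq> w" "x = Inr {v, w}"
proof -
  obtain e where e: "e \<in> struts G \<union> cables G \<union> bars G" "x = Inl e \<or> x = Inr e"
    using assms(2) by (auto simp: edgeset_def)
  then have "e \<subseteq> verts G" "card e = 2"
    using assms(1) by (auto simp: is_tensegrity_def)
  then obtain v w where "e = {v, w}" "v \<noteq> w" "v \<in> verts G" "w \<in> verts G"
    by (auto simp: card_2_iff)
  then show thesis using e(2) that by blast
qed

lemma continuous_map_pos:
  assumes "is_tensegrity G"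
  shows "continuous_map (vertex_topology G) euclidean (pos G)"
proof -
  have "openin (vertex_topology G) {v \<in> verts G. pos G v \<in> U}" if "open U" for U
    unfolding vertex_topology_eq(2)[OF assms]
  proof (intro conjI ballI)
    fix v assume "v \<in> {v \<in> verts G. pos G v \<in> U}"
    then obtain \<epsilon> where "0 < \<epsilon>" "\<forall>y. dist y (pos G v) < \<epsilon> \<longrightarrow> y \<in> U"
      using \<open>open U\<close> by (auto simp: open_dist)
    then have "\<forall>w\<in>verts G. vdist G v w < \<epsilon> \<longrightarrow> w \<in> {v \<in> verts G. pos G v \<in> U}"
      by (simp add: vdist_def dist_norm norm_minus_commute)
    then show "\<exists>\<epsilon>>0. \<forall>w\<in>verts G. vdist G v w < \<epsilon> \<longrightarrow> w \<in> {v \<in> verts G. pos G v \<in> U}"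
      using \<open>0 < \<epsilon>\<close> by blast
  qed blast
  then show ?thesis by (simp add: continuous_map_def vertex_topology_eq(1)[OF assms])
qed

lemma euclidean_motions_subset_variations:
  assumes "is_tensegrity G"
  shows "euclidean_motions G \<subseteq> variations G"
proof -
  have "continuous_map (vertex_topology G) euclidean (\<lambda>v. if v \<in> verts G then M *v pos G v + t else 0)" for M t
  proof (rule continuous_map_eq)
    have "continuous_map euclidean euclidean (\<lambda>y. M *v y + t)"
      by (auto intro!: continuous_intros simp: matrix_vector_mult_linear_continuous_on)
    from continuous_map_compose[OF continuous_map_pos[OF assms] this]
    show "continuous_map (vertex_topology G) euclidean (\<lambda>v. M *v pos G v + t)"
      by (simp add: o_def)
  qed (simp add: vertex_topology_eq(1)[OF assms])
  then show ?thesis unfolding euclidean_motions_def variations_def by auto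
qed

lemma rigidity_in_edge_functions:
  assumes G: "is_tensegrity G" and V: "V \<in> variations G"
  shows "rigidity G V \<in> edge_functions G"
proof -
  let ?T = "vertex_topology G"
  define F where "F c z = c * ((V (fst z) - V (snd z)) \<bullet> (pos G (fst z) - pos G (snd z)))" for c :: real and z
  have fs: "continuous_map (prod_topology ?T ?T) euclidean (\<lambda>z. h (fst z))"
           "continuous_map (prod_topology ?T ?T) euclidean (\<lambda>z. h (snd z))"
    if "continuous_map ?T euclidean h" for h :: "'a \<Rightarrow> real ^ 'b"
    using continuous_map_compose[OF continuous_map_fst that, of ?T]
      continuous_map_compose[OF continuous_map_snd that, of ?T] by (simp_all add: o_def)
  have Vc: "continuous_map ?T euclidean V" using V by (simp add: variations_def)
  have cont: "continuous_map (prod_topology ?T ?T) euclideanreal (F c)" for c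
  proof -
    let ?f = "\<lambda>z. V (fst z) - V (snd z)" and ?g = "\<lambda>z. pos G (fst z) - pos G (snd z)"
    have f: "continuous_map (prod_topology ?T ?T) euclidean ?f"
      by (intro continuous_map_diff fs Vc)
    have g: "continuous_map (prod_topology ?T ?T) euclidean ?g"
      by (intro continuous_map_diff fs continuous_map_pos G)
    have "continuous_map (prod_topology ?T ?T) (prod_topology euclidean euclidean) (\<lambda>z. (?f z, ?g z))"
      using f g by (intro continuous_map_pairedI)
    moreover have "continuous_map (prod_topology euclidean euclidean) euclideanreal
        (\<lambda>q :: (real^'b) \<times> (real^'b). c * (fst q \<bullet> snd q))"
      unfolding euclidean_product_topology by (auto intro!: continuous_intros)
    ultimately have "continuous_map (prod_topology ?T ?T) euclideanreal
        ((\<lambda>q. c * (fst q \<bullet> snd q)) \<circ> (\<lambda>z. (?f z, ?g z)))"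
      by (rule continuous_map_compose)
    then show ?thesis
      by (simp add: F_def[abs_def] o_def)
  qed
  have near: "\<exists>\<epsilon>>0. \<forall>a\<in>verts G. \<forall>b\<in>verts G. pair_dist G {v, w} {a, b} < \<epsilon> \<longrightarrow> c * pair_form G V {a, b} \<in> U"
    if "v \<in> verts G" "w \<in> verts G" "open U" "c * pair_form G V {v, w} \<in> U" for v w c U
  proof -
    let ?W = "{z \<in> topspace (prod_topology ?T ?T). F c z \<in> U}"
    have "openin (prod_topology ?T ?T) ?W"
      using openin_continuous_map_preimage[OF cont] that by simp
    moreover have "(v, w) \<in> ?W"
      using that by (simp add: F_def pair_form_eq vertex_topology_eq(1)[OF G])
    ultimately obtain A B where AB: "openin ?T A" "openin ?T B" "v \<in> A" "w \<in> B" "A \<times> B \<subseteq> ?W"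
      unfolding openin_prod_topology_alt by meson
    obtain r where r: "r > 0" "\<forall>u\<in>verts G. vdist G v u < r \<longrightarrow> u \<in> A"
      using AB by (auto simp: vertex_topology_eq(2)[OF G])
    obtain s where s: "s > 0" "\<forall>u\<in>verts G. vdist G w u < s \<longrightarrow> u \<in> B"
      using AB by (auto simp: vertex_topology_eq(2)[OF G])
    have "c * pair_form G V {a, b} \<in> U"
      if "a \<in> verts G" "b \<in> verts G" "pair_dist G {v, w} {a, b} < min r s" for a b
    proof -
      from that consider "vdist G v a < r" "vdist G w b < s" | "vdist G v b < r" "vdist G w a < s"
        unfolding pair_dist_eq by linarith
      then have "(a, b) \<in> ?W \<or> (b, a) \<in> ?W"
        using r s AB(5) that by cases blast+
      moreover have "pair_form G V {a, b} = pair_form G V {b, a}" by (simp add: insert_commute)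
      ultimately show ?thesis
        by (auto simp: F_def simp flip: pair_form_eq)
    qed
    then show ?thesis using r s by (intro exI[of _ "min r s"]) auto
  qed
  have "openin (edge_topology G) {x \<in> edgeset G. rigidity G V x \<in> U}" if "open U" for U
    unfolding openin_edge_topology
  proof (intro conjI ballI)
    fix x assume x: "x \<in> {x \<in> edgeset G. rigidity G V x \<in> U}"
    then have xE: "x \<in> edgeset G" by simp
    from G xE show "\<exists>\<epsilon>>0. \<forall>y\<in>edgeset G. edge_dist G x y < ereal \<epsilon> \<longrightarrow> y \<in> {x \<in> edgeset G. rigidity G V x \<in> U}"
    proof (cases rule: edge_cases)
      case (1 v w)
      then have "1 * pair_form G V {v, w} \<in> U" using x by (auto simp: rigidity_def)
      from near[OF 1(1,2) that this] obtain \<epsilon> where "\<epsilon> > 0"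
        and e: "\<And>a b. a \<in> verts G \<Longrightarrow> b \<in> verts G \<Longrightarrow> pair_dist G {v, w} {a, b} < \<epsilon> \<Longrightarrow> pair_form G V {a, b} \<in> U"
        by auto
      have "rigidity G V y \<in> U" if y: "y \<in> edgeset G" "edge_dist G x y < ereal \<epsilon>" for y
        using G y(1) by (cases rule: edge_cases) (use 1 y e in \<open>auto simp: rigidity_def\<close>)
      then show ?thesis using \<open>\<epsilon> > 0\<close> by blast
    next
      case (2 v w)
      then have "(-1) * pair_form G V {v, w} \<in> U" using x by (auto simp: rigidity_def)
      from near[OF 2(1,2) that this] obtain \<epsilon> where "\<epsilon> > 0"
        and e: "\<And>a b. a \<in> verts G \<Longrightarrow> b \<in> verts G \<Longrightarrow> pair_dist G {v, w} {a, b} < \<epsilon> \<Longrightarrow> - pair_form G V {a, b} \<in> U"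
        by auto
      have "rigidity G V y \<in> U" if y: "y \<in> edgeset G" "edge_dist G x y < ereal \<epsilon>" for y
        using G y(1) by (cases rule: edge_cases) (use 2 y e in \<open>auto simp: rigidity_def\<close>)
      then show ?thesis using \<open>\<epsilon> > 0\<close> by blast
    qed
  qed blast
  then have "continuous_map (edge_topology G) euclideanreal (rigidity G V)"
    by (simp add: continuous_map_def)
  then show ?thesis by (simp add: edge_functions_def rigidity_def)
qed

lemma sup_norm_eq:
  assumes G: "is_tensegrity G" and f: "f \<in> edge_functions G"
  shows "x \<in> edgeset G \<Longrightarrow> \<bar>f x\<bar> \<le> sup_norm G f"
    and "0 \<le> B \<Longrightarrow> (\<And>x. x \<in> edgeset G \<Longrightarrow> \<bar>f x\<bar> \<le> B) \<Longrightarrow> sup_norm G f \<le> B"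
proof -
  have "compactin (edge_topology G) (edgeset G)"
    using G by (simp add: is_tensegrity_def compact_space_def)
  then have "compactin euclideanreal (f ` edgeset G)"
    using f image_compactin unfolding edge_functions_def by blast
  then obtain b where "\<forall>y \<in> f ` edgeset G. \<bar>y\<bar> \<le> b"
    by (metis compactin_euclidean_iff compact_imp_bounded bounded_real)
  then have "bdd_above ((\<lambda>x. \<bar>f x\<bar>) ` edgeset G)"
    by (intro bdd_aboveI[of _ b]) auto
  then have "bdd_above (insert 0 ((\<lambda>x. \<bar>f x\<bar>) ` edgeset G))"
    by simp
  then show "x \<in> edgeset G \<Longrightarrow> \<bar>f x\<bar> \<le> sup_norm G f"
    unfolding sup_norm_def by (intro cSup_upper) auto
  show "0 \<le> B \<Longrightarrow> (\<And>x. x \<in> edgeset G \<Longrightarrow> \<bar>f x\<bar> \<le> B) \<Longrightarrow> sup_norm G f \<le> B"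
    unfolding sup_norm_def by (rule cSup_least) auto
qed

end

theory Submission imports Defs begin

text \<open>
  The rigidity operator maps the design variations onto a subspace \<open>L\<close> of \<open>C(E)\<close>. Bar equivalence
  prevents \<open>L\<close> from containing a strictly negative function, so the sublinear functional \<open>max\<close> is
  nonnegative on \<open>L\<close>, and Hahn-Banach yields a linear \<open>\<mu> \<le> max\<close> vanishing on \<open>L\<close>; such a \<open>\<mu>\<close> is
  positive and \<open>\<mu> 1 = 1\<close>. If \<open>\<mu>\<close> were not strictly positive, the complement \<open>U\<close> of its support would be
  a nonempty open proper subset, and minimality would give some \<open>g \<in> L\<close> that is nonnegative and
  not identically zero on the support. But then \<open>\<mu> g > 0\<close>.
\<close>

subsection \<open>Sublinear functionals on spaces of real functions\<close>

definition function_space :: "('a \<Rightarrow> real) set \<Rightarrow> bool" where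
  "function_space F \<longleftrightarrow> (\<lambda>x. 0) \<in> F \<and> (\<forall>f\<in>F. \<forall>g\<in>F. (\<lambda>x. f x + g x) \<in> F) \<and>
     (\<forall>f\<in>F. \<forall>c. (\<lambda>x. c * f x) \<in> F)"

text \<open>Homogeneity is demanded only as an inequality, the form that is checked directly for
  suprema and infima; \<open>sublinear_on_scale\<close> recovers equality.\<close>

definition sublinear_on :: "('a \<Rightarrow> real) set \<Rightarrow> (('a \<Rightarrow> real) \<Rightarrow> real) \<Rightarrow> bool" where
  "sublinear_on F q \<longleftrightarrow> (\<forall>f\<in>F. \<forall>g\<in>F. q (\<lambda>x. f x + g x) \<le> q f + q g) \<and>
     (\<forall>f\<in>F. \<forall>c\<ge>0. q (\<lambda>x. c * f x) \<le> c * q f)"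

lemma function_space_zero: "function_space F \<Longrightarrow> (\<lambda>x. 0) \<in> F"
  and function_space_add: "function_space F \<Longrightarrow> f \<in> F \<Longrightarrow> g \<in> F \<Longrightarrow> (\<lambda>x. f x + g x) \<in> F"
  and function_space_scale: "function_space F \<Longrightarrow> f \<in> F \<Longrightarrow> (\<lambda>x. c * f x) \<in> F"
  by (simp_all add: function_space_def)

lemma function_space_minus: "function_space F \<Longrightarrow> f \<in> F \<Longrightarrow> (\<lambda>x. - f x) \<in> F"
  using function_space_scale[of F f "-1"] by simp

lemma sublinear_on_add:
  "sublinear_on F q \<Longrightarrow> f \<in> F \<Longrightarrow> g \<in> F \<Longrightarrow> q (\<lambda>x. f x + g x) \<le> q f + q g"
  by (simp add: sublinear_on_def)

lemma sublinear_on_zero: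
  assumes "function_space F" "sublinear_on F q"
  shows "q (\<lambda>x. 0) = 0"
proof (rule antisym)
  have z: "(\<lambda>x. 0) \<in> F" by (rule function_space_zero[OF assms(1)])
  show "q (\<lambda>x. 0) \<le> 0"
    using assms(2) z unfolding sublinear_on_def by (auto dest!: bspec[OF _ z] spec[of _ "0::real"])
  show "0 \<le> q (\<lambda>x. 0)"
    using sublinear_on_add[OF assms(2) z z] by simp
qed

text \<open>For \<open>c \<noteq> 0\<close> the reverse inequality comes from scaling
  \<open>c * f\<close> back by \<open>inverse c\<close>.\<close>

lemma sublinear_on_scale:
  assumes F: "function_space F" and q: "sublinear_on F q" and f: "f \<in> F" and c: "0 \<le> c"
  shows "q (\<lambda>x. c * f x) = c * q f"
proof (cases "c = 0")
  case True
  then show ?thesis using sublinear_on_zero[OF F q] by simp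
next
  case False
  have "q (\<lambda>x. inverse c * (c * f x)) \<le> inverse c * q (\<lambda>x. c * f x)"
    using q function_space_scale[OF F f] c unfolding sublinear_on_def
    by (meson inverse_nonnegative_iff_nonnegative)
  then have "c * q f \<le> q (\<lambda>x. c * f x)"
    using False c by (simp add: field_simps)
  then show ?thesis
    using q f c unfolding sublinear_on_def by (meson antisym)
qed

lemma sublinear_on_minus:
  assumes F: "function_space F" and q: "sublinear_on F q" and f: "f \<in> F"
  shows "- q (\<lambda>x. - f x) \<le> q f"
  using sublinear_on_add[OF q f function_space_minus[OF F f]] sublinear_on_zero[OF F q] by simp

section \<open>Minimal sublinear functionals and the Hahn-Banach theorem\<close>

text \<open>Take \<open>r f\<close> to be the infimum of \<open>q (f + k) - a k\<close> over
  \<open>k\<close> in the convex cone \<open>K\<close>. The construction serves twice: with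
  \<open>a = 0\<close> on a subspace it prepares a functional vanishing there, and with
  \<open>a = q\<close> on a ray it shows that minimal functionals are odd.\<close>

lemma sublinear_on_below_cone:
  assumes F: "function_space F" and q: "sublinear_on F q"
    and K: "K \<subseteq> F" "(\<lambda>x. 0) \<in> K"
    and Kadd: "\<And>f g. f \<in> K \<Longrightarrow> g \<in> K \<Longrightarrow> (\<lambda>x. f x + g x) \<in> K"
    and Kscale: "\<And>f c. f \<in> K \<Longrightarrow> 0 < c \<Longrightarrow> (\<lambda>x. c * f x) \<in> K"
    and a0: "a (\<lambda>x. 0) = 0"
    and aadd: "\<And>f g. f \<in> K \<Longrightarrow> g \<in> K \<Longrightarrow> a f + a g \<le> a (\<lambda>x. f x + g x)"
    and ascale: "\<And>f c. f \<in> K \<Longrightarrow> 0 < c \<Longrightarrow> c * a f \<le> a (\<lambda>x. c * f x)"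
    and aq: "\<And>f. f \<in> K \<Longrightarrow> a f \<le> q f"
  obtains r where "sublinear_on F r" "\<And>f. f \<in> F \<Longrightarrow> r f \<le> q f"
    "\<And>k. k \<in> K \<Longrightarrow> r (\<lambda>x. - k x) \<le> - a k"
proof -
  define r where "r f = (INF k\<in>K. q (\<lambda>x. f x + k x) - a k)" for f
  \<comment> \<open>The infimum is finite: subadditivity for \<open>k = - f + (f + k)\<close>
    together with \<open>a k \<le> q k\<close> gives a bound independent of
    \<open>k\<close>.\<close>
  have bdd: "bdd_below ((\<lambda>k. q (\<lambda>x. f x + k x) - a k) ` K)" if f: "f \<in> F" for f
  proof (rule bdd_belowI2[of _ "- q (\<lambda>x. - f x)"])
    fix k assume k: "k \<in> K"
    then have "k \<in> F" using K by blast
    then have "q (\<lambda>x. - f x + (f x + k x)) \<le> q (\<lambda>x. - f x) + q (\<lambda>x. f x + k x)"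
      by (intro sublinear_on_add[OF q] function_space_minus function_space_add F f)
    then show "- q (\<lambda>x. - f x) \<le> q (\<lambda>x. f x + k x) - a k"
      using aq[OF k] by simp
  qed
  have up: "r f \<le> q (\<lambda>x. f x + k x) - a k" if "f \<in> F" "k \<in> K" for f k
    unfolding r_def using that by (intro cINF_lower bdd)
  have low: "t \<le> r f" if "\<And>k. k \<in> K \<Longrightarrow> t \<le> q (\<lambda>x. f x + k x) - a k" for t f
    unfolding r_def using that K by (intro cINF_greatest) auto
  have "r (\<lambda>x. f x + g x) \<le> r f + r g" if f: "f \<in> F" and g: "g \<in> F" for f g
  proof -
    \<comment> \<open>Near-optimal \<open>k\<close> for \<open>f\<close> and \<open>l\<close> for
      \<open>g\<close> combine to the competitor \<open>k + l\<close> for \<open>f + g\<close>;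
      superadditivity of \<open>a\<close> has the right direction.\<close>
    have "r (\<lambda>x. f x + g x) - (q (\<lambda>x. g x + l x) - a l) \<le> q (\<lambda>x. f x + k x) - a k"
      if k: "k \<in> K" and l: "l \<in> K" for k l
    proof -
      have kl: "k \<in> F" "l \<in> F" using k l K by auto
      have "r (\<lambda>x. f x + g x) \<le> q (\<lambda>x. (f x + g x) + (k x + l x)) - a (\<lambda>x. k x + l x)"
        by (rule up[OF function_space_add[OF F f g] Kadd[OF k l]])
      also have "(\<lambda>x. (f x + g x) + (k x + l x)) = (\<lambda>x. (f x + k x) + (g x + l x))"
        by (simp add: algebra_simps)
      also have "q \<dots> \<le> q (\<lambda>x. f x + k x) + q (\<lambda>x. g x + l x)"
        by (intro sublinear_on_add[OF q] function_space_add F f g kl)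
      finally show ?thesis using aadd[OF k l] by simp
    qed
    then have "r (\<lambda>x. f x + g x) - r f \<le> q (\<lambda>x. g x + l x) - a l" if "l \<in> K" for l
      using low[of "r (\<lambda>x. f x + g x) - (q (\<lambda>x. g x + l x) - a l)" f] that by fastforce
    then show ?thesis using low[of "r (\<lambda>x. f x + g x) - r f" g] by fastforce
  qed
  moreover have "r (\<lambda>x. c * f x) \<le> c * r f" if f: "f \<in> F" and c: "0 \<le> c" for f c
  proof (cases "c = 0")
    case True
    then show ?thesis
      using up[OF function_space_zero[OF F] K(2)] a0 sublinear_on_zero[OF F q] by simp
  next
    case False
    then have c: "0 < c" using c by simp
    \<comment> \<open>The cone is invariant under positive scaling, so \<open>c * k\<close> competes
      for \<open>c * f\<close> whenever \<open>k\<close> competes for \<open>f\<close>.\<close>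
    have "r (\<lambda>x. c * f x) / c \<le> q (\<lambda>x. f x + k x) - a k" if k: "k \<in> K" for k
    proof -
      have "k \<in> F" using k K by auto
      have "r (\<lambda>x. c * f x) \<le> q (\<lambda>x. c * f x + c * k x) - a (\<lambda>x. c * k x)"
        by (rule up[OF function_space_scale[OF F f] Kscale[OF k c]])
      also have "(\<lambda>x. c * f x + c * k x) = (\<lambda>x. c * (f x + k x))"
        by (simp add: algebra_simps)
      also have "q \<dots> = c * q (\<lambda>x. f x + k x)"
        using c by (intro sublinear_on_scale[OF F q] function_space_add F f \<open>k \<in> F\<close>) simp
      finally have "r (\<lambda>x. c * f x) \<le> c * (q (\<lambda>x. f x + k x) - a k)"
        using ascale[OF k c] by (simp add: algebra_simps)
      then show ?thesis using c by (simp add: field_simps)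
    qed
    then have "r (\<lambda>x. c * f x) / c \<le> r f" by (rule low)
    then show ?thesis using c by (simp add: field_simps)
  qed
  ultimately have "sublinear_on F r" by (simp add: sublinear_on_def)
  moreover have "r f \<le> q f" if "f \<in> F" for f
    using up[OF that K(2)] a0 by simp
  \<comment> \<open>The element \<open>k\<close> itself is the competitor, which leaves
    \<open>q 0 - a k\<close>.\<close>
  moreover have "r (\<lambda>x. - k x) \<le> - a k" if k: "k \<in> K" for k
    using up[OF function_space_minus[OF F] k, of k] k K sublinear_on_zero[OF F q] by auto
  ultimately show thesis by (rule that)
qed

text \<open>Zorn's lemma: the pointwise infimum of a chain of sublinear functionals below
  \<open>p\<close> is again sublinear. Minimality is what later forces linearity.\<close>

lemma minimal_sublinear_on:
  assumes F: "function_space F" and p: "sublinear_on F p"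
  obtains q where "sublinear_on F q" "\<And>f. f \<in> F \<Longrightarrow> q f \<le> p f"
    "\<And>r f. sublinear_on F r \<Longrightarrow> (\<And>f. f \<in> F \<Longrightarrow> r f \<le> q f) \<Longrightarrow> f \<in> F \<Longrightarrow> r f = q f"
proof -
  \<comment> \<open>Values off \<open>F\<close> are pinned to 0 so that the order on total functions
    compares values on \<open>F\<close> only; \<open>cut\<close> brings a functional into this
    form.\<close>
  define A where "A = {q. sublinear_on F q \<and> (\<forall>f\<in>F. q f \<le> p f) \<and> (\<forall>f. f \<notin> F \<longrightarrow> q f = 0)}"
  define cut where "cut q f = (if f \<in> F then q f else (0::real))" for q f
  have cut: "sublinear_on F (cut q) \<longleftrightarrow> sublinear_on F q" for q
    using F by (simp add: sublinear_on_def cut_def function_space_add function_space_scale)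
  \<comment> \<open>The order is reversed, so the upper bounds that Zorn's lemma asks for are lower
    bounds of chains of functionals.\<close>
  have "\<exists>q\<in>A. \<forall>r\<in>A. r \<le> q \<longrightarrow> r = q"
  proof (rule predicate_Zorn[of A "\<lambda>q r. r \<le> q"])
    show "partial_order_on A (relation_of (\<lambda>q r. r \<le> q) A)"
      by (rule partial_order_on_relation_ofI) auto
    fix C assume C: "C \<in> Chains (relation_of (\<lambda>q r. r \<le> q) A)"
    show "\<exists>u\<in>A. \<forall>a\<in>C. u \<le> a"
    proof (cases "C = {}")
      case True
      have "cut p \<in> A" using p by (simp add: A_def cut) (simp add: cut_def)
      then show ?thesis using True by blast
    next
      case False
      have CA: "C \<subseteq> A" using C by (auto simp: Chains_def relation_of_def)
      have tot: "q \<le> r \<or> r \<le> q" if "q \<in> C" "r \<in> C" for q r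
        using C that by (auto simp: Chains_def relation_of_def)
      define u where "u f = (INF q\<in>C. q f)" for f
      \<comment> \<open>All members of the chain share the lower bound \<open>- p (- f)\<close>,
        because each is sublinear and lies below \<open>p\<close>.\<close>
      have bdd: "bdd_below ((\<lambda>q. q f) ` C)" if f: "f \<in> F" for f
      proof (rule bdd_belowI2[of _ "- p (\<lambda>x. - f x)"])
        fix q assume "q \<in> C"
        then have "sublinear_on F q" "q (\<lambda>x. - f x) \<le> p (\<lambda>x. - f x)"
          using CA function_space_minus[OF F f] by (auto simp: A_def)
        then show "- p (\<lambda>x. - f x) \<le> q f" using sublinear_on_minus[OF F _ f, of q] by linarith
      qed
      have up: "u f \<le> q f" if "f \<in> F" "q \<in> C" for f q
        unfolding u_def using that by (intro cINF_lower bdd)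
      have low: "t \<le> u f" if "\<And>q. q \<in> C \<Longrightarrow> t \<le> q f" for t f
        unfolding u_def using that False by (intro cINF_greatest) auto
      have "u (\<lambda>x. f x + g x) \<le> u f + u g" if f: "f \<in> F" and g: "g \<in> F" for f g
      proof -
        have "u (\<lambda>x. f x + g x) - r g \<le> q f" if q: "q \<in> C" and r: "r \<in> C" for q r
        proof -
          \<comment> \<open>The smaller of \<open>q\<close> and \<open>r\<close> lies below both, so
            subadditivity of a single member of the chain suffices.\<close>
          obtain s where s: "s \<in> C" "s \<le> q" "s \<le> r" using tot[OF q r] q r by blast
          then have "sublinear_on F s" using CA by (auto simp: A_def)
          then have "s (\<lambda>x. f x + g x) \<le> s f + s g" using f g by (rule sublinear_on_add)
          with up[OF function_space_add[OF F f g] s(1)] le_funD[OF s(2), of f] le_funD[OF s(3), of g]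
          show ?thesis by linarith
        qed
        then have "u (\<lambda>x. f x + g x) - u f \<le> r g" if "r \<in> C" for r
          using low[of "u (\<lambda>x. f x + g x) - r g" f] that by fastforce
        then show ?thesis using low[of "u (\<lambda>x. f x + g x) - u f" g] by fastforce
      qed
      moreover have "u (\<lambda>x. c * f x) \<le> c * u f" if f: "f \<in> F" and c: "0 \<le> c" for f c
      proof -
        have le: "u (\<lambda>x. c * f x) \<le> c * q f" if q: "q \<in> C" for q
        proof -
          have "sublinear_on F q" using q CA by (auto simp: A_def)
          from sublinear_on_scale[OF F this f c] show ?thesis
            using up[OF function_space_scale[OF F f, of c] q] by simp
        qed
        show ?thesis
        proof (cases "c = 0")
          case True
          then show ?thesis using le False by fastforce
        next
          case nz: False
          then have "u (\<lambda>x. c * f x) / c \<le> u f"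
            using c le by (intro low) (simp add: field_simps)
          then show ?thesis using nz c by (simp add: field_simps)
        qed
      qed
      ultimately have "sublinear_on F u" by (simp add: sublinear_on_def)
      moreover have "u f \<le> p f" if "f \<in> F" for f
      proof -
        obtain q where "q \<in> C" using False by blast
        then show ?thesis using up[OF that, of q] CA that by (force simp: A_def)
      qed
      ultimately have "cut u \<in> A" by (simp add: A_def cut) (simp add: cut_def)
      moreover have "cut u \<le> q" if "q \<in> C" for q
        using that CA up by (auto simp: le_fun_def cut_def A_def)
      ultimately show ?thesis by blast
    qed
  qed
  then obtain q where q: "q \<in> A" and min: "\<And>r. r \<in> A \<Longrightarrow> r \<le> q \<Longrightarrow> r = q" by blast
  show thesis
  proof
    show "sublinear_on F q" "\<And>f. f \<in> F \<Longrightarrow> q f \<le> p f" using q by (auto simp: A_def)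
    fix r f assume r: "sublinear_on F r" "\<And>f. f \<in> F \<Longrightarrow> r f \<le> q f" and f: "f \<in> F"
    have "cut r \<in> A"
      using r q by (auto simp: A_def cut) (auto simp: cut_def intro: order_trans)
    moreover have "cut r \<le> q"
      using r q by (auto simp: le_fun_def cut_def A_def)
    ultimately have "cut r = q" by (rule min)
    then show "r f = q f" using f by (auto simp: cut_def)
  qed
qed

text \<open>First lower \<open>p\<close> to \<open>p'\<close> with \<open>p' \<le> 0\<close> on
  \<open>L\<close>, then take a minimal sublinear \<open>\<mu>\<close> below \<open>p'\<close>.
  Minimality makes \<open>\<mu>\<close> odd, an odd sublinear functional is linear, and
  \<open>\<mu> \<le> 0\<close> on the subspace \<open>L\<close> forces \<open>\<mu> = 0\<close>
  there.\<close>

lemma hahn_banach: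
  assumes F: "function_space F" and p: "sublinear_on F p"
    and L: "function_space L" "L \<subseteq> F" and pL: "\<And>g. g \<in> L \<Longrightarrow> 0 \<le> p g"
  obtains \<mu> where "\<And>f g. f \<in> F \<Longrightarrow> g \<in> F \<Longrightarrow> \<mu> (\<lambda>x. f x + g x) = \<mu> f + \<mu> g"
    "\<And>f c. f \<in> F \<Longrightarrow> \<mu> (\<lambda>x. c * f x) = c * \<mu> f"
    "\<And>f. f \<in> F \<Longrightarrow> \<mu> f \<le> p f"
    "\<And>g. g \<in> L \<Longrightarrow> \<mu> g = (0::real)"
proof -
  obtain p' where p': "sublinear_on F p'" "\<And>f. f \<in> F \<Longrightarrow> p' f \<le> p f"
    and p'L: "\<And>k. k \<in> L \<Longrightarrow> p' (\<lambda>x. - k x) \<le> - 0"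
    by (rule sublinear_on_below_cone[OF F p L(2) function_space_zero[OF L(1)]
          function_space_add[OF L(1)] function_space_scale[OF L(1)], where a = "\<lambda>_. 0"])
       (use pL in auto)
  obtain \<mu> where \<mu>: "sublinear_on F \<mu>" and \<mu>p: "\<And>f. f \<in> F \<Longrightarrow> \<mu> f \<le> p' f"
    and min: "\<And>r f. sublinear_on F r \<Longrightarrow> (\<And>f. f \<in> F \<Longrightarrow> r f \<le> \<mu> f) \<Longrightarrow> f \<in> F \<Longrightarrow> r f = \<mu> f"
    by (rule minimal_sublinear_on[OF F p'(1)]) blast
  \<comment> \<open>Subtracting along the ray through \<open>f\<close> cannot lower the minimal \<open>\<mu>\<close>, so \<open>\<mu>\<close> is odd.\<close>
  have neg: "\<mu> (\<lambda>x. - f x) = - \<mu> f" if f: "f \<in> F" for f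
  proof -
    let ?K = "{(\<lambda>x. t * f x) | t. 0 \<le> t}"
    have K: "?K \<subseteq> F" "(\<lambda>x. 0) \<in> ?K" "f \<in> ?K"
      using function_space_scale[OF F f] by (auto intro: exI[of _ 0] exI[of _ 1])
    obtain r where r: "sublinear_on F r" "\<And>f. f \<in> F \<Longrightarrow> r f \<le> \<mu> f"
      and rK: "\<And>k. k \<in> ?K \<Longrightarrow> r (\<lambda>x. - k x) \<le> - \<mu> k"
    proof (rule sublinear_on_below_cone[OF F \<mu> K(1,2), where a = \<mu>])
      fix g h assume "g \<in> ?K" "h \<in> ?K"
      then obtain s t where st: "0 \<le> s" "0 \<le> t" "g = (\<lambda>x. s * f x)" "h = (\<lambda>x. t * f x)" by auto
      then have eq: "(\<lambda>x. g x + h x) = (\<lambda>x. (s + t) * f x)" by (simp add: algebra_simps)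
      show "(\<lambda>x. g x + h x) \<in> ?K"
        unfolding eq using st by (auto intro!: exI[of _ "s + t"])
      show "\<mu> g + \<mu> h \<le> \<mu> (\<lambda>x. g x + h x)"
        unfolding eq using st sublinear_on_scale[OF F \<mu> f] by (simp add: distrib_right[of s t "\<mu> f"])
    next
      fix g and c :: real assume "g \<in> ?K" "0 < c"
      then show "(\<lambda>x. c * g x) \<in> ?K"
        by (auto simp flip: mult.assoc)
      show "c * \<mu> g \<le> \<mu> (\<lambda>x. c * g x)"
        using \<open>g \<in> ?K\<close> \<open>0 < c\<close> K sublinear_on_scale[OF F \<mu>, of g c] by auto
    qed (auto simp: sublinear_on_zero[OF F \<mu>])
    have "r (\<lambda>x. - f x) = \<mu> (\<lambda>x. - f x)"
      by (rule min[OF r function_space_minus[OF F f]])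
    then show ?thesis using rK[OF K(3)] sublinear_on_minus[OF F \<mu> f] by linarith
  qed
  have pos: "0 \<le> \<mu> g" if "g \<in> L" for g
  proof -
    have "g \<in> F" using that L by blast
    then show ?thesis
      using p'L[OF that] \<mu>p[OF function_space_minus[OF F]] neg by fastforce
  qed
  show thesis
  proof
    fix f g assume f: "f \<in> F" and g: "g \<in> F"
    \<comment> \<open>Removing \<open>g\<close> again turns subadditivity into the missing
      inequality, since \<open>\<mu>\<close> is odd.\<close>
    have "\<mu> (\<lambda>x. (f x + g x) + - g x) \<le> \<mu> (\<lambda>x. f x + g x) + \<mu> (\<lambda>x. - g x)"
      by (intro sublinear_on_add[OF \<mu>] function_space_add function_space_minus F f g)
    then show "\<mu> (\<lambda>x. f x + g x) = \<mu> f + \<mu> g"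
      using neg[OF g] sublinear_on_add[OF \<mu> f g] by simp
  next
    fix f and c :: real assume f: "f \<in> F"
    show "\<mu> (\<lambda>x. c * f x) = c * \<mu> f"
    proof (cases "0 \<le> c")
      case True
      then show ?thesis by (rule sublinear_on_scale[OF F \<mu> f])
    next
      case False
      then show ?thesis
        using sublinear_on_scale[OF F \<mu> f, of "- c"] neg[OF function_space_scale[OF F f], of c] by simp
    qed
  next
    fix f assume "f \<in> F"
    then show "\<mu> f \<le> p f" using \<mu>p p'(2) order_trans by blast
  next
    fix g assume g: "g \<in> L"
    then show "\<mu> g = 0"
      using pos[OF g] pos[OF function_space_minus[OF L(1) g]] neg L(2) by fastforce
  qed
qed

subsection \<open>Strictly positive functionals on a compact space\<close>

text \<open>This repeats the convention of \<open>edge_functions\<close> for an arbitrary topology,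
  so that the argument can be carried out without tensegrities.\<close>

definition continuous_functions :: "'a topology \<Rightarrow> ('a \<Rightarrow> real) set" where
  "continuous_functions T =
     {f. continuous_map T euclideanreal f \<and> (\<forall>x. x \<notin> topspace T \<longrightarrow> f x = 0)}"

lemma function_space_continuous_functions: "function_space (continuous_functions T)"
  by (auto simp: function_space_def continuous_functions_def intro!: continuous_intros)

lemma continuous_functions_max:
  assumes "f \<in> continuous_functions T"
  shows "(\<lambda>x. max (f x) 0) \<in> continuous_functions T"
  using assms
  by (auto simp: continuous_functions_def intro!: continuous_map_real_max)

text \<open>This is the constant function 1 under the convention that functions vanish off the
  carrier.\<close>

lemma continuous_functions_indicator: "indicat_real (topspace T) \<in> continuous_functions T"
proof -
  have "continuous_map T euclideanreal (indicat_real (topspace T))"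
    by (rule continuous_map_eq[of _ _ "\<lambda>x. 1"]) auto
  then show ?thesis by (simp add: continuous_functions_def)
qed

lemma compact_image_continuous_functions:
  assumes "compact_space T" "f \<in> continuous_functions T"
  shows "compact (f ` topspace T)"
  using assms image_compactin[of T "topspace T" euclideanreal f]
  by (simp add: continuous_functions_def compact_space_def)

lemma continuous_functions_le_Sup:
  assumes "compact_space T" "f \<in> continuous_functions T" "x \<in> topspace T"
  shows "f x \<le> (SUP y\<in>topspace T. f y)"
  using compact_image_continuous_functions[OF assms(1,2)] assms(3)
  by (intro cSUP_upper compact_imp_bounded bounded_imp_bdd_above)

section \<open>Positive functionals and their null sets\<close>

locale positive_functional =
  fixes T :: "'a topology" and \<mu> :: "('a \<Rightarrow> real) \<Rightarrow> real"
  assumes compact: "compact_space T"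
    and add: "\<And>f g. f \<in> continuous_functions T \<Longrightarrow> g \<in> continuous_functions T \<Longrightarrow>
      \<mu> (\<lambda>x. f x + g x) = \<mu> f + \<mu> g"
    and scale: "\<And>f c. f \<in> continuous_functions T \<Longrightarrow> \<mu> (\<lambda>x. c * f x) = c * \<mu> f"
    and nonneg: "\<And>f. f \<in> continuous_functions T \<Longrightarrow> (\<And>x. x \<in> topspace T \<Longrightarrow> 0 \<le> f x) \<Longrightarrow> 0 \<le> \<mu> f"
begin

lemmas fs = function_space_continuous_functions[of T]

lemma mono:
  assumes f: "f \<in> continuous_functions T" and g: "g \<in> continuous_functions T"
    and le: "\<And>x. x \<in> topspace T \<Longrightarrow> f x \<le> g x"
  shows "\<mu> f \<le> \<mu> g"
proof -
  have "0 \<le> \<mu> (\<lambda>x. g x + (-1) * f x)"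
    using le by (intro nonneg function_space_add function_space_scale fs f g) auto
  then show ?thesis
    using add[OF g function_space_scale[OF fs f, of "-1"]] scale[OF f, of "-1"] by simp
qed

text \<open>It plays the part of the complement of the support of \<open>\<mu>\<close>, expressed by
  test functions so that no representing measure is involved.\<close>

definition null_set :: "'a set" where
  "null_set = {x \<in> topspace T. \<exists>f\<in>continuous_functions T.
     (\<forall>y\<in>topspace T. 0 \<le> f y) \<and> \<mu> f = 0 \<and> 0 < f x}"

lemma openin_positive_set:
  assumes "f \<in> continuous_functions T"
  shows "openin T {x \<in> topspace T. 0 < f x}"
  using openin_continuous_map_preimage[of T euclideanreal f "{0<..}"] assms
  by (simp add: continuous_functions_def)

lemma openin_null_set: "openin T null_set"
proof -
  have "null_set = \<Union> ((\<lambda>f. {x \<in> topspace T. 0 < f x}) `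
      {f \<in> continuous_functions T. (\<forall>y\<in>topspace T. 0 \<le> f y) \<and> \<mu> f = 0})"
    by (auto simp: null_set_def)
  then show ?thesis using openin_positive_set by auto
qed

text \<open>By compactness finitely many null functions have positivity sets covering
  \<open>K\<close>; their sum is still null and is positive on all of \<open>K\<close>.\<close>

lemma null_function_on_compact:
  assumes K: "compactin T K" "K \<subseteq> null_set"
  obtains f where "f \<in> continuous_functions T" "\<And>x. x \<in> topspace T \<Longrightarrow> 0 \<le> f x" "\<mu> f = 0"
    "\<And>x. x \<in> K \<Longrightarrow> 0 < f x"
proof -
  define N where "N = {f \<in> continuous_functions T. (\<forall>y\<in>topspace T. 0 \<le> f y) \<and> \<mu> f = 0}"
  have zero: "(\<lambda>x. 0) \<in> N"
    using function_space_zero[OF fs] scale[OF function_space_zero[OF fs], of 0] by (simp add: N_def)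
  have plus: "(\<lambda>x. f x + g x) \<in> N" if "f \<in> N" "g \<in> N" for f g
    using that by (simp add: N_def add function_space_add[OF fs])
  let ?P = "\<lambda>f. {x \<in> topspace T. 0 < f x}"
  have "K \<subseteq> \<Union> (?P ` N)" using K(2) by (auto simp: null_set_def N_def)
  moreover have "\<forall>S\<in>?P ` N. openin T S" using openin_positive_set by (auto simp: N_def)
  ultimately obtain \<F> where \<F>: "finite \<F>" "\<F> \<subseteq> ?P ` N" "K \<subseteq> \<Union>\<F>"
    using compactinD[OF K(1), of "?P ` N"] by blast
  obtain M where "M \<subseteq> N" "finite M" "\<F> = ?P ` M"
    using finite_subset_image[OF \<F>(1,2)] by blast
  with \<F>(3) have M: "finite M" "M \<subseteq> N" "K \<subseteq> \<Union> (?P ` M)" by simp_all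
  have "\<exists>f\<in>N. \<forall>x\<in>\<Union> (?P ` M). 0 < f x"
    using M(1,2)
  proof induction
    case empty
    then show ?case using zero by auto
  next
    case (insert h M)
    then obtain f where f: "f \<in> N" "\<forall>x\<in>\<Union> (?P ` M). 0 < f x" by auto
    have h: "h \<in> N" using insert by simp
    have "0 < f x + h x" if "x \<in> \<Union> (?P ` insert h M)" for x
    proof -
      have "x \<in> topspace T" "0 < h x \<or> x \<in> \<Union> (?P ` M)" using that by auto
      moreover have "0 \<le> h x" "0 \<le> f x" using f h \<open>x \<in> topspace T\<close> by (auto simp: N_def)
      ultimately show ?thesis using f(2) by (meson add_nonneg_pos add_pos_nonneg)
    qed
    then show ?case by (intro bexI[OF _ plus[OF f(1) h]] ballI)
  qed
  then obtain f where "f \<in> N" "\<And>x. x \<in> K \<Longrightarrow> 0 < f x"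
    using M(3) by (meson subsetD)
  then show thesis by (intro that[of f]) (auto simp: N_def)
qed

text \<open>The set where \<open>g \<ge> \<epsilon>\<close> is compact and lies in
  \<open>null_set\<close>, so a multiple of a single null function dominates \<open>g\<close> there.
  Elsewhere \<open>g < \<epsilon>\<close>, whence \<open>\<mu> g\<close> is at most
  \<open>\<epsilon>\<close> times the total mass.\<close>

lemma functional_zero_if_zero_off_null_set:
  assumes g: "g \<in> continuous_functions T" and nn: "\<And>x. x \<in> topspace T \<Longrightarrow> 0 \<le> g x"
    and sub: "\<And>x. x \<in> topspace T \<Longrightarrow> x \<notin> null_set \<Longrightarrow> g x = 0"
  shows "\<mu> g = 0"
proof -
  let ?one = "indicat_real (topspace T)"
  note one = continuous_functions_indicator[of T]
  have le: "\<mu> g \<le> \<epsilon> * \<mu> ?one" if \<epsilon>: "0 < \<epsilon>" for \<epsilon>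
  proof -
    let ?K = "{x \<in> topspace T. g x \<in> {\<epsilon>..}}"
    have "closedin T ?K"
      using g by (intro closedin_continuous_map_preimage[of T euclideanreal])
        (auto simp: continuous_functions_def)
    then have K: "compactin T ?K" by (rule closedin_compact_space[OF compact])
    moreover have "?K \<subseteq> null_set" using sub \<epsilon> by force
    ultimately obtain f where f: "f \<in> continuous_functions T" "\<And>x. x \<in> topspace T \<Longrightarrow> 0 \<le> f x" "\<mu> f = 0"
      and fK: "\<And>x. x \<in> ?K \<Longrightarrow> 0 < f x"
      by (rule null_function_on_compact) blast
    \<comment> \<open>\<open>C\<close> is the supremum of \<open>g\<close> divided by the minimum of
      \<open>f\<close> on the compact set; an empty set has no minimum and gets
      \<open>C = 0\<close>.\<close>
    obtain C where C: "\<And>x. x \<in> ?K \<Longrightarrow> g x \<le> C * f x" "0 \<le> C"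
    proof (cases "?K = {}")
      case True
      then show thesis using that[of 0] by blast
    next
      case False
      have "compact (f ` ?K)"
        using image_compactin[OF K, of euclideanreal f] f(1) by (simp add: continuous_functions_def)
      then obtain x0 where x0: "x0 \<in> ?K" "\<And>x. x \<in> ?K \<Longrightarrow> f x0 \<le> f x"
        using compact_attains_inf[of "f ` ?K"] False by blast
      let ?B = "SUP y\<in>topspace T. g y"
      have B: "g x \<le> ?B" if "x \<in> topspace T" for x
        by (rule continuous_functions_le_Sup[OF compact g that])
      have B0: "0 \<le> ?B" using B[of x0] nn[of x0] x0(1) by auto
      have "g x \<le> ?B / f x0 * f x" if x: "x \<in> ?K" for x
      proof -
        have "?B * f x0 \<le> ?B * f x" using x0(2)[OF x] B0 by (rule mult_left_mono)
        then have "?B \<le> ?B / f x0 * f x" using fK[OF x0(1)] by (simp add: field_simps)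
        then show ?thesis using B[of x] x by simp
      qed
      moreover have "0 \<le> ?B / f x0" using B0 fK[OF x0(1)] by simp
      ultimately show thesis by (rule that)
    qed
    have "\<mu> g \<le> \<mu> (\<lambda>x. \<epsilon> * ?one x + C * f x)"
    proof (rule mono[OF g])
      show "(\<lambda>x. \<epsilon> * ?one x + C * f x) \<in> continuous_functions T"
        by (intro function_space_add function_space_scale fs one f)
      fix x assume x: "x \<in> topspace T"
      show "g x \<le> \<epsilon> * ?one x + C * f x"
      proof (cases "x \<in> ?K")
        case True
        then show ?thesis using C(1)[OF True] \<epsilon> x by simp
      next
        case False
        then show ?thesis using x C(2) f(2)[OF x] by (simp add: add_increasing2)
      qed
    qed
    also have "\<dots> = \<epsilon> * \<mu> ?one"
      using add[OF function_space_scale[OF fs one] function_space_scale[OF fs f(1)]]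
        scale[OF one] scale[OF f(1)] f(3) by simp
    finally show ?thesis .
  qed
  have "\<mu> g \<le> 0 + \<epsilon>" if "0 < \<epsilon>" for \<epsilon>
  proof -
    have m: "0 \<le> \<mu> ?one" by (rule nonneg[OF one]) simp
    \<comment> \<open>The added 1 keeps the denominator positive even if the total mass is
      0.\<close>
    have "\<mu> g \<le> \<epsilon> / (\<mu> ?one + 1) * \<mu> ?one"
      by (rule le) (use that m in simp)
    also have "\<dots> \<le> \<epsilon>" using that m by (simp add: field_simps)
    finally show ?thesis by simp
  qed
  then have "\<mu> g \<le> 0" by (rule field_le_epsilon)
  then show ?thesis using nonneg[OF g nn] by simp
qed

text \<open>The negative part of \<open>g\<close> lives inside \<open>null_set\<close> and is
  therefore null. Then the positive part is null as well, and a nonnegative null function cannot be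
  positive outside \<open>null_set\<close>.\<close>

lemma zero_off_null_set:
  assumes g: "g \<in> continuous_functions T" and nn: "\<And>x. x \<in> topspace T - null_set \<Longrightarrow> 0 \<le> g x"
    and g0: "\<mu> g = 0" and x: "x \<in> topspace T - null_set"
  shows "g x = 0"
proof -
  define gp where "gp = (\<lambda>x. max (g x) 0)"
  define gm where "gm = (\<lambda>x. max (- g x) 0)"
  have gp: "gp \<in> continuous_functions T" and gm: "gm \<in> continuous_functions T"
    unfolding gp_def gm_def by (intro continuous_functions_max function_space_minus fs g)+
  have "\<mu> gm = 0"
    using nn by (intro functional_zero_if_zero_off_null_set gm) (auto simp: gm_def)
  moreover have "(\<lambda>x. g x + gm x) = gp" by (auto simp: gp_def gm_def)
  ultimately have "\<mu> gp = 0" using add[OF g gm] g0 by simp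
  then have "\<not> 0 < gp x" using gp x by (auto simp: null_set_def gp_def)
  then show ?thesis using nn[OF x] by (simp add: gp_def max_def split: if_splits)
qed

lemma functional_zero_if_null_set_eq_topspace:
  assumes "null_set = topspace T" "f \<in> continuous_functions T" "\<And>x. x \<in> topspace T \<Longrightarrow> 0 \<le> f x"
  shows "\<mu> f = 0"
  using assms by (intro functional_zero_if_zero_off_null_set) auto

end

section \<open>Strictly positive functionals vanishing on a subspace\<close>

text \<open>Here \<open>L\<close> stands for the image of the design variations under the rigidity
  operator; \<open>pos\<close> expresses bar equivalence and \<open>minimal\<close> its failure on
  every proper nonempty closed part obtained by deleting an open set. The bound by the supremum is
  kept in the conclusion because it yields continuity.\<close>

theorem strictly_positive_annihilator:
  assumes T: "compact_space T" "topspace T \<noteq> {}"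
    and L: "function_space L" "L \<subseteq> continuous_functions T"
    and pos: "\<And>g. g \<in> L \<Longrightarrow> \<forall>x\<in>topspace T. 0 \<le> g x \<Longrightarrow> g = (\<lambda>x. 0)"
    and minimal: "\<And>U. openin T U \<Longrightarrow> U \<noteq> {} \<Longrightarrow> topspace T - U \<noteq> {} \<Longrightarrow>
      \<exists>g\<in>L. (\<forall>x\<in>topspace T - U. 0 \<le> g x) \<and> (\<exists>x\<in>topspace T - U. g x \<noteq> 0)"
  obtains \<mu> where
    "\<And>f g. f \<in> continuous_functions T \<Longrightarrow> g \<in> continuous_functions T \<Longrightarrow>
      \<mu> (\<lambda>x. f x + g x) = \<mu> f + \<mu> g"
    "\<And>f c. f \<in> continuous_functions T \<Longrightarrow> \<mu> (\<lambda>x. c * f x) = c * \<mu> f"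
    "\<And>f. f \<in> continuous_functions T \<Longrightarrow> \<mu> f \<le> (SUP x\<in>topspace T. f x)"
    "\<And>g. g \<in> L \<Longrightarrow> \<mu> g = 0"
    "\<And>f. f \<in> continuous_functions T \<Longrightarrow> \<forall>x\<in>topspace T. 0 \<le> f x \<Longrightarrow> f \<noteq> (\<lambda>x. 0) \<Longrightarrow> 0 < \<mu> f"
proof -
  let ?F = "continuous_functions T" and ?p = "\<lambda>f. SUP x\<in>topspace T. f x :: real"
  note F = function_space_continuous_functions[of T]
  have Sup_le: "?p f \<le> b" if "\<And>x. x \<in> topspace T \<Longrightarrow> f x \<le> b" for f b
    using that T(2) by (intro cSUP_least) auto
  note le_Sup = continuous_functions_le_Sup[OF T(1)]
  have p: "sublinear_on ?F ?p"
    unfolding sublinear_on_def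
    by (auto intro!: Sup_le add_mono le_Sup mult_left_mono)
  have pL: "0 \<le> ?p g" if g: "g \<in> L" for g
  proof (rule ccontr)
    assume "\<not> 0 \<le> ?p g"
    then have neg: "g x < 0" if "x \<in> topspace T" for x
      using le_Sup[of g x] g L(2) that by fastforce
    \<comment> \<open>If the supremum were negative, \<open>- g\<close> would be a nonnegative
      member of \<open>L\<close>, hence zero, although it is strictly positive on a nonempty
      space.\<close>
    then have "(\<lambda>x. - g x) = (\<lambda>x. 0)"
      using pos[OF function_space_minus[OF L(1) g]] by (meson less_imp_le neg_0_le_iff_le)
    then show False using neg T(2) by (metis all_not_in_conv less_irrefl neg_equal_0_iff_equal)
  qed
  obtain \<mu> where \<mu>:
    "\<And>f g. f \<in> ?F \<Longrightarrow> g \<in> ?F \<Longrightarrow> \<mu> (\<lambda>x. f x + g x) = \<mu> f + \<mu> g"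
    "\<And>f c. f \<in> ?F \<Longrightarrow> \<mu> (\<lambda>x. c * f x) = c * \<mu> f"
    and \<mu>p: "\<And>f. f \<in> ?F \<Longrightarrow> \<mu> f \<le> ?p f" and \<mu>L: "\<And>g. g \<in> L \<Longrightarrow> \<mu> g = 0"
    by (rule hahn_banach[OF F p L pL]) blast+
  have nonneg: "0 \<le> \<mu> f" if f: "f \<in> ?F" "\<And>x. x \<in> topspace T \<Longrightarrow> 0 \<le> f x" for f
  proof -
    \<comment> \<open>Positivity follows from the upper bound evaluated at \<open>- f\<close>, whose
      supremum is at most 0.\<close>
    have "\<mu> (\<lambda>x. (-1) * f x) \<le> ?p (\<lambda>x. (-1) * f x)"
      by (rule \<mu>p[OF function_space_scale[OF F f(1)]])
    also have "\<dots> \<le> 0" by (rule Sup_le) (use f in auto)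
    finally show ?thesis using \<mu>(2)[OF f(1), of "-1"] by simp
  qed
  interpret positive_functional T \<mu>
    by unfold_locales (use T \<mu> nonneg in auto)
  have "0 < \<mu> f" if f: "f \<in> ?F" "\<forall>x\<in>topspace T. 0 \<le> f x" "f \<noteq> (\<lambda>x. 0)" for f
  proof (rule ccontr)
    assume "\<not> 0 < \<mu> f"
    then have "\<mu> f = 0" using nonneg[OF f(1)] f(2) by force
    obtain x0 where "f x0 \<noteq> 0" using f(3) by blast
    then have "x0 \<in> topspace T" using f(1) by (auto simp: continuous_functions_def)
    then have "0 < f x0" using f(2) \<open>f x0 \<noteq> 0\<close> by (metis less_eq_real_def)
    then have "x0 \<in> null_set"
      using f \<open>\<mu> f = 0\<close> \<open>x0 \<in> topspace T\<close> by (auto simp: null_set_def)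
    \<comment> \<open>The upper bound at the constant -1 gives \<open>\<mu> ?one \<ge> 1\<close>, so
      the null set cannot be the whole space.\<close>
    moreover have "topspace T - null_set \<noteq> {}"
    proof
      let ?one = "indicat_real (topspace T)"
      note one = continuous_functions_indicator[of T]
      assume "topspace T - null_set = {}"
      then have "null_set = topspace T" by (auto simp: null_set_def)
      then have "\<mu> ?one = 0" by (rule functional_zero_if_null_set_eq_topspace[OF _ one]) simp
      moreover have "\<mu> (\<lambda>x. (-1) * ?one x) \<le> ?p (\<lambda>x. (-1) * ?one x)"
        by (rule \<mu>p[OF function_space_scale[OF F one]])
      moreover have "?p (\<lambda>x. (-1) * ?one x) \<le> -1" by (rule Sup_le) simp
      ultimately show False using \<mu>(2)[OF one, of "-1"] by simp
    qed
    \<comment> \<open>Minimality is used with \<open>U = null_set\<close>. The resulting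
      \<open>g\<close> has \<open>\<mu> g = 0\<close> because it lies in \<open>L\<close>, so it
      must vanish off \<open>null_set\<close>, contrary to its choice.\<close>
    ultimately obtain g where "g \<in> L" "\<forall>x\<in>topspace T - null_set. 0 \<le> g x"
      "\<exists>x\<in>topspace T - null_set. g x \<noteq> 0"
      using minimal[OF openin_null_set] by blast
    then show False using zero_off_null_set[of g] \<mu>L L(2) by blast
  qed
  with \<mu> \<mu>p \<mu>L show thesis by (rule that)
qed

subsection \<open>Tensegrities\<close>

lemma edge_functions_eq: "edge_functions G = continuous_functions (edge_topology G)"
  by (simp add: edge_functions_def continuous_functions_def)

lemma rigidity_zero:
  assumes "is_tensegrity G"
  shows "rigidity G (\<lambda>v. 0) = (\<lambda>x. 0)"
proof
  fix x
  show "rigidity G (\<lambda>v. 0) x = 0"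
  proof (cases "x \<in> edgeset G")
    case True
    with assms show ?thesis
      by (cases rule: edge_cases) (auto simp: rigidity_def pair_form_eq)
  qed (simp add: rigidity_def)
qed

lemma rigidity_add:
  assumes "is_tensegrity G"
  shows "rigidity G (\<lambda>v. V v + W v) = (\<lambda>x. rigidity G V x + rigidity G W x)"
proof
  fix x
  show "rigidity G (\<lambda>v. V v + W v) x = rigidity G V x + rigidity G W x"
  proof (cases "x \<in> edgeset G")
    case True
    with assms show ?thesis
      by (cases rule: edge_cases) (auto simp: rigidity_def pair_form_eq inner_add_left inner_diff_left)
  qed (simp add: rigidity_def)
qed

lemma rigidity_scaleR:
  assumes "is_tensegrity G"
  shows "rigidity G (\<lambda>v. c *\<^sub>R V v) = (\<lambda>x. c * rigidity G V x)"
proof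
  fix x
  show "rigidity G (\<lambda>v. c *\<^sub>R V v) x = c * rigidity G V x"
  proof (cases "x \<in> edgeset G")
    case True
    with assms show ?thesis
      by (cases rule: edge_cases)
        (auto simp: rigidity_def pair_form_eq inner_diff_left right_diff_distrib)
  qed (simp add: rigidity_def)
qed

lemma function_space_rigidity:
  assumes "is_tensegrity G" "design_variations G X"
  shows "function_space (rigidity G ` X)"
  unfolding function_space_def
proof (intro conjI ballI allI)
  have X: "(\<lambda>v. 0) \<in> X" "\<And>V W. V \<in> X \<Longrightarrow> W \<in> X \<Longrightarrow> (\<lambda>v. V v + W v) \<in> X"
    "\<And>V c. V \<in> X \<Longrightarrow> (\<lambda>v. c *\<^sub>R V v) \<in> X"
    using assms(2) by (simp_all add: design_variations_def)
  show "(\<lambda>x. 0) \<in> rigidity G ` X"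
    using X(1) rigidity_zero[OF assms(1)] by (metis imageI)
  show "(\<lambda>x. f x + g x) \<in> rigidity G ` X" if "f \<in> rigidity G ` X" "g \<in> rigidity G ` X" for f g
    using that X(2) by (auto simp flip: rigidity_add[OF assms(1)])
  show "(\<lambda>x. c * f x) \<in> rigidity G ` X" if "f \<in> rigidity G ` X" for f c
    using that X(3) by (auto simp flip: rigidity_scaleR[OF assms(1)])
qed

text \<open>Applying the one-sided bound to \<open>f\<close> and \<open>- f\<close> bounds the
  absolute value; \<open>\<mu>\<close> is then Lipschitz with constant 1, and
  \<open>\<delta> = \<epsilon>\<close> works.\<close>

lemma dual_spaceI:
  assumes G: "is_tensegrity G"
    and add: "\<And>f g. f \<in> edge_functions G \<Longrightarrow> g \<in> edge_functions G \<Longrightarrow> \<mu> (\<lambda>x. f x + g x) = \<mu> f + \<mu> g"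
    and scale: "\<And>f c. f \<in> edge_functions G \<Longrightarrow> \<mu> (\<lambda>x. c * f x) = c * \<mu> f"
    and bound: "\<And>f. f \<in> edge_functions G \<Longrightarrow> \<mu> f \<le> sup_norm G f"
  shows "\<mu> \<in> dual_space G"
proof -
  note F = function_space_continuous_functions[of "edge_topology G", folded edge_functions_eq]
  have abs: "\<bar>\<mu> f\<bar> \<le> sup_norm G f" if f: "f \<in> edge_functions G" for f
    using bound[OF f] bound[OF function_space_minus[OF F f]] scale[OF f, of "-1"]
    by (simp add: sup_norm_def abs_le_iff)
  have "\<bar>\<mu> g - \<mu> f\<bar> \<le> sup_norm G (\<lambda>x. g x - f x)"
    if f: "f \<in> edge_functions G" and g: "g \<in> edge_functions G" for f g
    using add[OF g function_space_minus[OF F f]] scale[OF f, of "-1"]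
      abs[OF function_space_add[OF F g function_space_minus[OF F f]]] by simp
  then have "\<forall>f\<in>edge_functions G. \<forall>\<epsilon>>0. \<exists>\<delta>>0. \<forall>g\<in>edge_functions G.
      sup_norm G (\<lambda>x. g x - f x) < \<delta> \<longrightarrow> \<bar>\<mu> g - \<mu> f\<bar> < \<epsilon>"
    by (meson le_less_trans)
  then show ?thesis using add scale by (simp add: dual_space_def)
qed

theorem theorem3p8p3:
  fixes G :: "('v, 'n::finite) tensegrity"
    and X :: "('v \<Rightarrow> real ^ 'n) set"
  assumes "is_tensegrity G"
    and "design_variations G X"
    and "minimally_bar_equivalent G X"
  shows "\<exists>\<mu>. strictly_positive_stress G X \<mu>"
proof (cases "edgeset G = {}")
  case True
  \<comment> \<open>Without edges the zero function is the only edge function, so the zero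
    functional is strictly positive vacuously. The remaining case has the nonempty space over which
    suprema are taken.\<close>
  then have "f = (\<lambda>x. 0)" if "f \<in> edge_functions G" for f
    using that by (auto simp: edge_functions_def)
  then have "strictly_positive_stress G X (\<lambda>_. 0)"
    by (auto simp: strictly_positive_stress_def stress_def dual_space_def nonneg_edge_functions_def
        intro: exI[of _ "1::real"])
  then show ?thesis by blast
next
  case False
  let ?T = "edge_topology G" and ?L = "rigidity G ` X"
  have L: "?L \<subseteq> edge_functions G"
    using assms(1,2) rigidity_in_edge_functions by (auto simp: design_variations_def)
  have T: "compact_space ?T" using assms(1) by (simp add: is_tensegrity_def)
  have pos: "g = (\<lambda>x. 0)" if "g \<in> ?L" "\<forall>x\<in>topspace ?T. 0 \<le> g x" for g
    using that assms(3) L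
    by (auto simp: minimally_bar_equivalent_def bar_equivalent_def nonneg_edge_functions_def)
  have minimal: "\<exists>g\<in>?L. (\<forall>x\<in>topspace ?T - U. 0 \<le> g x) \<and> (\<exists>x\<in>topspace ?T - U. g x \<noteq> 0)"
    if "openin ?T U" "U \<noteq> {}" "topspace ?T - U \<noteq> {}" for U
    using that assms(3) by (auto simp: minimally_bar_equivalent_def sub_bar_equivalent_def)
  obtain \<mu> where \<mu>:
    "\<And>f g. f \<in> edge_functions G \<Longrightarrow> g \<in> edge_functions G \<Longrightarrow> \<mu> (\<lambda>x. f x + g x) = \<mu> f + \<mu> g"
    "\<And>f c. f \<in> edge_functions G \<Longrightarrow> \<mu> (\<lambda>x. c * f x) = c * \<mu> f"
    "\<And>f. f \<in> edge_functions G \<Longrightarrow> \<mu> f \<le> (SUP x\<in>edgeset G. f x)"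
    "\<And>g. g \<in> ?L \<Longrightarrow> \<mu> g = 0"
    "\<And>f. f \<in> edge_functions G \<Longrightarrow> \<forall>x\<in>edgeset G. 0 \<le> f x \<Longrightarrow> f \<noteq> (\<lambda>x. 0) \<Longrightarrow> 0 < \<mu> f"
    by (rule strictly_positive_annihilator[OF T _ function_space_rigidity[OF assms(1,2)]
          L[unfolded edge_functions_eq] pos minimal, folded edge_functions_eq])
       (use False in auto)
  have "\<mu> f \<le> sup_norm G f" if f: "f \<in> edge_functions G" for f
  proof -
    have "(SUP x\<in>edgeset G. f x) \<le> sup_norm G f"
      using sup_norm_eq(1)[OF assms(1) f] False by (intro cSUP_least) (auto intro: abs_le_D1)
    then show ?thesis using \<mu>(3)[OF f] by simp
  qed
  then have "\<mu> \<in> dual_space G" using \<mu>(1,2) by (intro dual_spaceI[OF assms(1)])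
  then have "strictly_positive_stress G X \<mu>"
    using \<mu>(4,5) by (auto simp: strictly_positive_stress_def stress_def nonneg_edge_functions_def)
  then show ?thesis by blast
qed

end
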